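(* Let $(A,\mu)$ be an associative $k$-algebra equipped with a Nijenhuis operator $\beta: A\to A$. Define three binary operations $\prec_\beta,\succ_\beta,\bullet_\beta: A^{\otimes 2}\to A$ by $$x\prec_\beta y := x\beta(y),\qquad x\succ_\beta y:=\beta(x)y,\qquad x\bullet_\beta y := -\beta(xy)$$ for all $x,y\in A$. Then $A^\beta:=(A,\prec_\beta,\succ_\beta,\bullet_\beta)$ is an $NS$-algebra.
   Context: Throughout, $k$ is a field of characteristic zero. A Nijenhuis operator on an associative algebra $A$ is a linear map $\beta:A\to A$ such that $\beta(x)\beta(y)+\beta^2(xy)=\beta(\beta(x)y+x\beta(y))$ for all $x,y\in A$. An $NS$-algebra is a $k$-vector space $N$ with three bilinear operations $\prec,\succ,\bullet$ such that, with $x\star y:=x\prec y+x\succ y+x\bullet y$, for all $x,y,z$: $(x\prec y)\prec z=x\prec(y\star z)$; $(x\succ y)\prec z=x\succ(y\prec z)$; $(x\star y)\succ z=x\succ(y\succ z)$; $(x\star y)\bullet z+(x\bullet y)\prec z=x\succ(y\bullet z)+x\bullet(y\star z)$. *)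

theory Defs
  imports Complex_Main
begin

text \<open>Bilinearity over the field acting through \<open>scale\<close>;
  such an \<open>f\<close> stands for a linear map on the tensor square.\<close>

definition bilinear_op ::
    "('k::field \<Rightarrow> 'a::ab_group_add \<Rightarrow> 'a) \<Rightarrow> ('a \<Rightarrow> 'a \<Rightarrow> 'a) \<Rightarrow> bool" where
  "bilinear_op scale f \<longleftrightarrow>
     (\<forall>x. Vector_Spaces.linear scale scale (\<lambda>y. f x y)) \<and>
     (\<forall>y. Vector_Spaces.linear scale scale (\<lambda>x. f x y))"

text \<open>The class \<^class>\<open>ring\<close> provides an associative, biadditive multiplication with no unit
  required, so the algebras below need not be unital.\<close>

locale assoc_algebra = vector_space scale
  for scale :: "'k::field_char_0 \<Rightarrow> 'a::ring \<Rightarrow> 'a" +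
  assumes bilinear_mult: "bilinear_op scale (\<lambda>x y. x * y)"

locale nijenhuis_operator = assoc_algebra scale
  for scale :: "'k::field_char_0 \<Rightarrow> 'a::ring \<Rightarrow> 'a" +
  fixes \<beta> :: "'a \<Rightarrow> 'a"
  assumes linear_op: "Vector_Spaces.linear scale scale \<beta>"
    and nijenhuis: "\<beta> x * \<beta> y + \<beta> (\<beta> (x * y)) = \<beta> (\<beta> x * y + x * \<beta> y)"

definition ns_star ::
    "('a::ab_group_add \<Rightarrow> 'a \<Rightarrow> 'a) \<Rightarrow> ('a \<Rightarrow> 'a \<Rightarrow> 'a) \<Rightarrow> ('a \<Rightarrow> 'a \<Rightarrow> 'a) \<Rightarrow> 'a \<Rightarrow> 'a \<Rightarrow> 'a" where
  "ns_star lft rgt bul x y = lft x y + rgt x y + bul x y"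

text \<open>The operations \<open>lft\<close>, \<open>rgt\<close>, \<open>bul\<close> are
  \<open>\<prec>\<close>, \<open>\<succ>\<close>, \<open>\<bullet>\<close> respectively.\<close>

locale ns_algebra = vector_space scale
  for scale :: "'k::field_char_0 \<Rightarrow> 'a::ab_group_add \<Rightarrow> 'a" +
  fixes lft rgt bul :: "'a \<Rightarrow> 'a \<Rightarrow> 'a"
  assumes bilinear_lft: "bilinear_op scale lft"
    and bilinear_rgt: "bilinear_op scale rgt"
    and bilinear_bul: "bilinear_op scale bul"
    and lft_lft: "lft (lft x y) z = lft x (ns_star lft rgt bul y z)"
    and rgt_lft: "lft (rgt x y) z = rgt x (lft y z)"
    and star_rgt: "rgt (ns_star lft rgt bul x y) z = rgt x (rgt y z)"
    and star_bul: "bul (ns_star lft rgt bul x y) z + lft (bul x y) z =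
                   rgt x (bul y z) + bul x (ns_star lft rgt bul y z)"

end

(* The Nijenhuis identity says exactly that \<beta> is multiplicative from \<star> to the product of A,
   which gives the first and third axioms; the second is associativity.  In the last one, expanding
   \<beta>(xy) \<beta>(z) and \<beta>(x) \<beta>(yz) by the Nijenhuis identity turns both sides into
   \<beta>(\<beta>(xyz)) - \<beta>(\<beta>(x) y z) - \<beta>(x \<beta>(y) z) - \<beta>(x y \<beta>(z)). *)
theory Submission imports Defs begin

text \<open>\<open>Vector_Spaces.linear\<close> bundles the vector space axioms with the two
  linearity laws; supplying those axioms once leaves only equations, which can be checked by
  rewriting.\<close>

lemma bilinear_op_iff:
  assumes "vector_space scale"
  shows "bilinear_op scale f \<longleftrightarrow>
    (\<forall>x y z. f x (y + z) = f x y + f x z) \<and> (\<forall>c x y. f x (scale c y) = scale c (f x y)) \<and>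
    (\<forall>x y z. f (x + y) z = f x z + f y z) \<and> (\<forall>c x y. f (scale c x) y = scale c (f x y))"
  using assms by (auto simp: bilinear_op_def Vector_Spaces.linear_iff)

context nijenhuis_operator
begin

lemma beta_add: "\<beta> (x + y) = \<beta> x + \<beta> y"
  and beta_diff: "\<beta> (x - y) = \<beta> x - \<beta> y"
  and beta_scale: "\<beta> (scale c x) = scale c (\<beta> x)"
proof -
  interpret Vector_Spaces.linear scale scale \<beta>
    by (rule linear_op)
  show "\<beta> (x + y) = \<beta> x + \<beta> y" "\<beta> (x - y) = \<beta> x - \<beta> y" "\<beta> (scale c x) = scale c (\<beta> x)"
    by (rule add diff scale)+
qed

lemma mult_scale: "x * scale c y = scale c (x * y)" "scale c x * y = scale c (x * y)"
  using bilinear_mult bilinear_op_iff[OF vector_space_axioms] by blast+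

text \<open>The Nijenhuis identity solved for the product, as a rewrite rule that moves a product of
  two values of \<open>\<beta>\<close> under \<open>\<beta>\<close>.\<close>

lemma beta_mult: "\<beta> x * \<beta> y = \<beta> (\<beta> x * y) + \<beta> (x * \<beta> y) - \<beta> (\<beta> (x * y))"
  using nijenhuis[of x y] by (simp add: beta_add eq_diff_eq)

lemma ns_algebra_nijenhuis:
  "ns_algebra scale (\<lambda>x y. x * \<beta> y) (\<lambda>x y. \<beta> x * y) (\<lambda>x y. - \<beta> (x * y))"
proof
  show "bilinear_op scale (\<lambda>x y. x * \<beta> y)" "bilinear_op scale (\<lambda>x y. \<beta> x * y)"
    "bilinear_op scale (\<lambda>x y. - \<beta> (x * y))"
    by (simp_all add: bilinear_op_iff vector_space_axioms beta_add beta_scale mult_scale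
        distrib_left distrib_right)
next
  fix x y z
  let ?star = "ns_star (\<lambda>x y. x * \<beta> y) (\<lambda>x y. \<beta> x * y) (\<lambda>x y. - \<beta> (x * y))"
  have star: "?star u v = u * \<beta> v + \<beta> u * v - \<beta> (u * v)" for u v
    by (simp add: ns_star_def)
  have beta_star: "\<beta> (?star u v) = \<beta> u * \<beta> v" for u v
    by (simp add: star beta_mult beta_add beta_diff)
  show "x * \<beta> y * \<beta> z = x * \<beta> (?star y z)" "\<beta> (?star x y) * z = \<beta> x * (\<beta> y * z)"
    by (simp_all add: beta_star mult.assoc)
  show "\<beta> x * y * \<beta> z = \<beta> x * (y * \<beta> z)"
    by (rule mult.assoc)
  \<comment> \<open>The term \<open>\<beta> (\<beta> (x * y) * z)\<close> cancels on the left and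
    \<open>\<beta> (x * \<beta> (y * z))\<close> on the right: each arises once from
    \<open>?star\<close> and once, with opposite sign, from \<open>beta_mult\<close>.\<close>
  show "- \<beta> (?star x y * z) + - \<beta> (x * y) * \<beta> z =
      \<beta> x * - \<beta> (y * z) + - \<beta> (x * ?star y z)"
    by (simp add: star beta_mult beta_add beta_diff algebra_simps)
qed

end

theorem proposition2p2:
  fixes scale :: "'k::field_char_0 \<Rightarrow> 'a::ring \<Rightarrow> 'a"
    and \<beta> :: "'a \<Rightarrow> 'a"
  assumes "nijenhuis_operator scale \<beta>"
  shows "ns_algebra scale (\<lambda>x y. x * \<beta> y) (\<lambda>x y. \<beta> x * y) (\<lambda>x y. - \<beta> (x * y))"
  using assms by (rule nijenhuis_operator.ns_algebra_nijenhuis)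

end
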